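(* Let $\mathcal{F}$ be a filter on $\mathbb{N}$ (not necessarily projective). Let $(e_n)_{n=1}^\infty$ be an $\mathcal{F}$-basis of a Banach space $X$ over $\mathbb{K}$ with continuous coordinate functionals. Then there exists an analytic filter $\mathcal{F}'\subset\mathcal{F}$ on $\mathbb{N}$ such that $(e_n)_{n=1}^\infty$ is also an $\mathcal{F}'$-basis of $X$.
   Context: $\mathbb{K}$ is the fixed scalar field, either $\mathbb{R}$ or $\mathbb{C}$. A filter on $\mathbb{N}=\{1,2,\dots\}$ is a family of subsets of $\mathbb{N}$ closed under finite intersections and upwards-closed with respect to inclusion; by convention, every filter is assumed to contain all cofinite subsets of $\mathbb{N}$. Subsets of $\mathbb{N}$ are identified with their characteristic functions, so a filter is regarded as a subset of the Cantor set $\{0,1\}^{\mathbb{N}}$ with the product topology; it is analytic if it is a continuous image of a Polish space. A sequence $(x_n)_{n=1}^\infty$ in a normed space $\mathcal{F}$-converges to $x$ if for every $\varepsilon>0$ there is $A\in\mathcal{F}$ such that $\|x-x_n\|<\varepsilon$ for all $n\in A$. A sequence $(e_n)_{n=1}^\infty$ in a Banach space $X$ is an $\mathcal{F}$-basis of $X$ if for each $x\in X$ there is a unique sequence of scalars $(e_n^*(x))_{n=1}^\infty$ such that $x=\sum_{n,\mathcal{F}}e_n^*(x)e_n$, meaning that the partial sums $\sum_{i=1}^n e_i^*(x)e_i$ $\mathcal{F}$-converge to $x$. The linear maps $x\mapsto e_n^*(x)$ are the coordinate functionals of the basis. *)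

theory Defs
  imports "HOL-Analysis.Analysis"
begin

text \<open>The scalar fields \<open>\<real>\<close> and \<open>\<complex>\<close>, up to isometric isomorphism.\<close>

class real_or_complex = real_normed_field +
  assumes real_or_complex: "\<exists>h :: 'a \<Rightarrow> complex.
    (\<forall>x y. h (x + y) = h x + h y) \<and> (\<forall>x y. h (x * y) = h x * h y) \<and>
    (\<forall>r x. h (r *\<^sub>R x) = r *\<^sub>R h x) \<and> (\<forall>x. norm (h x) = norm x) \<and>
    (range h = \<real> \<or> range h = UNIV)"

instance real :: real_or_complex
  by standard (rule exI[of _ complex_of_real], simp add: Reals_def scaleR_conv_of_real)

instance complex :: real_or_complex
  by standard (rule exI[of _ id], simp)

text \<open>
  The library has only real normed spaces, so a normed space over \<open>'k\<close> is a real normed space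
  with a scalar multiplication by \<open>'k\<close> that extends the real one. For \<open>'k = real\<close> this forces
  \<open>smul = scaleR\<close>. A Banach space over \<open>'k\<close> is such a space on a type of class \<open>banach\<close>.
\<close>

locale normed_space_over = vector_space smul
  for smul :: "'k::real_or_complex \<Rightarrow> 'a::real_normed_vector \<Rightarrow> 'a" +
  assumes smul_of_real: "smul (of_real r) x = r *\<^sub>R x"
    and norm_smul: "norm (smul c x) = norm c * norm x"

text \<open>
  Sequences are indexed from \<open>0\<close>: the index \<open>n\<close> here stands for \<open>n + 1\<close> in \<open>{1, 2, \<dots>}\<close>, so that the
  partial sum attached to the index \<open>n\<close> has the terms \<open>0, \<dots>, n\<close>. A filter is a \<open>nat filter\<close>,
  identified with the family of sets \<open>{A. eventually (\<lambda>n. n \<in> A) F}\<close>; it contains all cofinite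
  sets iff \<open>F \<le> cofinite\<close>. Beware that the order on the type \<open>filter\<close> is reverse inclusion of
  these families.
\<close>

definition has_filter_expansion ::
  "nat filter \<Rightarrow> ('k \<Rightarrow> 'a \<Rightarrow> 'a) \<Rightarrow> (nat \<Rightarrow> 'a::real_normed_vector) \<Rightarrow> (nat \<Rightarrow> 'k) \<Rightarrow> 'a \<Rightarrow> bool"
  where "has_filter_expansion F smul e a x \<longleftrightarrow> ((\<lambda>n. \<Sum>i\<le>n. smul (a i) (e i)) \<longlongrightarrow> x) F"

definition filter_basis ::
  "nat filter \<Rightarrow> ('k \<Rightarrow> 'a \<Rightarrow> 'a) \<Rightarrow> (nat \<Rightarrow> 'a::real_normed_vector) \<Rightarrow> bool"
  where "filter_basis F smul e \<longleftrightarrow> (\<forall>x. \<exists>!a. has_filter_expansion F smul e a x)"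

definition coordinate_functional ::
  "nat filter \<Rightarrow> ('k \<Rightarrow> 'a \<Rightarrow> 'a) \<Rightarrow> (nat \<Rightarrow> 'a::real_normed_vector) \<Rightarrow> nat \<Rightarrow> 'a \<Rightarrow> 'k"
  where "coordinate_functional F smul e n x = (THE a. has_filter_expansion F smul e a x) n"

definition Polish_space :: "'a topology \<Rightarrow> bool"
  where "Polish_space X \<longleftrightarrow> completely_metrizable_space X \<and> second_countable X"

text \<open>
  A Polish space has at most continuum many points, so every Polish space is homeomorphic to one
  whose underlying set is a set of reals (with a topology unrelated to that of the real line).
  Quantifying over \<open>real topology\<close> therefore covers all Polish spaces.
\<close>

definition analytic_in :: "'a topology \<Rightarrow> 'a set \<Rightarrow> bool"
  where "analytic_in T S \<longleftrightarrow>
    (\<exists>(X :: real topology) f. Polish_space X \<and> continuous_map X T f \<and> f ` topspace X = S)"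

definition Cantor_space :: "(nat \<Rightarrow> bool) topology"
  where "Cantor_space = product_topology (\<lambda>_. discrete_topology UNIV) UNIV"

text \<open>The predicates \<open>P\<close> below are the characteristic functions of the sets in the filter.\<close>

definition analytic_filter :: "nat filter \<Rightarrow> bool"
  where "analytic_filter F \<longleftrightarrow> analytic_in Cantor_space {P. eventually P F}"

end

theory Submission imports Defs begin

text \<open>
  Let \<open>S n\<close> be the \<open>n\<close>-th partial sum operator of the basis, formed with the coordinate functionals of
  \<open>F\<close>. Among all filters that contain the cofinite sets and along which \<open>S n x\<close> tends to \<open>x\<close> for every
  \<open>x\<close>, there is one with the fewest sets: it is generated by the final segments and the sets
  \<open>{n. dist (S n x) x < \<epsilon>}\<close>. This is the filter \<open>approx_filter S\<close>, and it has the required properties.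
  All its sets lie in \<open>F\<close> (\<open>le_approx_filter\<close>). Hence each expansion along it is also an expansion along
  \<open>F\<close>, so the uniqueness of expansions is inherited from \<open>F\<close>; their existence is built into the
  construction (\<open>tendsto_approx_filter\<close>).

  It remains to see that this filter is analytic (\<open>analytic_approx_filter\<close>). A set \<open>P\<close> belongs to it iff
  finitely many generators witness this. The witnesses can be coded by a number \<open>m\<close> and a sequence \<open>x\<close>
  of points of the space, in such a way that the triples \<open>(m, x, P)\<close> where \<open>(m, x)\<close> witnesses that \<open>P\<close> is in
  the filter form a closed set: this is where the continuity of the \<open>S n\<close>, and so of the coordinate
  functionals, enters. The filter is the projection of that closed set to the Cantor space. The
  space of all triples is Polish because the Banach space is separable, and it is separable because
  finite combinations of basis vectors with coefficients from a countable dense set of scalars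
  are dense (\<open>second_countable_if_expansions\<close>).
\<close>

section \<open>Polish spaces and their continuous images\<close>

lemma second_countable_prod_topology:
  assumes "second_countable X" and "second_countable Y"
  shows "second_countable (prod_topology X Y)"
proof -
  obtain A where A: "countable A" "\<And>V. V \<in> A \<Longrightarrow> openin X V"
    "\<And>U x. openin X U \<Longrightarrow> x \<in> U \<Longrightarrow> \<exists>V\<in>A. x \<in> V \<and> V \<subseteq> U"
    using assms(1) unfolding second_countable_def by metis
  obtain B where B: "countable B" "\<And>V. V \<in> B \<Longrightarrow> openin Y V"
    "\<And>U x. openin Y U \<Longrightarrow> x \<in> U \<Longrightarrow> \<exists>V\<in>B. x \<in> V \<and> V \<subseteq> U"
    using assms(2) unfolding second_countable_def by metis
  show ?thesis
    unfolding second_countable_def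
  proof (intro exI conjI strip)
    show "countable ((\<lambda>(a, b). a \<times> b) ` (A \<times> B))"
      using A(1) B(1) by simp
    show "openin (prod_topology X Y) V" if "V \<in> (\<lambda>(a, b). a \<times> b) ` (A \<times> B)" for V
      using that A(2) B(2) by (auto simp: openin_prod_Times_iff)
    show "\<exists>V\<in>(\<lambda>(a, b). a \<times> b) ` (A \<times> B). p \<in> V \<and> V \<subseteq> U"
      if U: "openin (prod_topology X Y) U \<and> p \<in> U" for U p
    proof -
      obtain x y where p: "p = (x, y)" by fastforce
      obtain U1 U2 where "openin X U1" "openin Y U2" "x \<in> U1" "y \<in> U2" and sub: "U1 \<times> U2 \<subseteq> U"
        using U unfolding p openin_prod_topology_alt by blast
      then obtain a b where "a \<in> A" "x \<in> a" "a \<subseteq> U1" "b \<in> B" "y \<in> b" "b \<subseteq> U2"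
        using A(3) B(3) by meson
      then show ?thesis
        using sub p by (intro bexI[of _ "a \<times> b"]) auto
    qed
  qed
qed

lemma second_countable_product_topology:
  fixes X :: "'i::countable \<Rightarrow> 'a topology"
  assumes "\<And>i. second_countable (X i)"
  shows "second_countable (product_topology X UNIV)"
proof -
  obtain B where B: "\<And>i. countable (B i)" "\<And>i V. V \<in> B i \<Longrightarrow> openin (X i) V"
    "\<And>i U x. openin (X i) U \<Longrightarrow> x \<in> U \<Longrightarrow> \<exists>V\<in>B i. x \<in> V \<and> V \<subseteq> U"
    using assms unfolding second_countable_def by metis
  define B' where "B' i = insert (topspace (X i)) (B i)" for i
  define K where "K = PiE UNIV ` {Y. (\<forall>i. Y i \<in> B' i) \<and> finite {i. Y i \<noteq> topspace (X i)}}"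
  have B'_open: "openin (X i) V" if "V \<in> B' i" for i V
    using that B(2) by (auto simp: B'_def)
  show ?thesis
    unfolding second_countable_def
  proof (intro exI conjI strip)
    \<comment> \<open>The default value \<open>topspace (X i)\<close> depends on \<open>i\<close>; it is coded by \<open>None\<close> to make it constant.\<close>
    define Z where "Z = {z. (\<forall>i. z i \<in> insert None (Some ` B i)) \<and> finite {i. z i \<noteq> None}}"
    have "Y \<in> (\<lambda>z i. case z i of None \<Rightarrow> topspace (X i) | Some V \<Rightarrow> V) ` Z"
      if "\<forall>i. Y i \<in> B' i" "finite {i. Y i \<noteq> topspace (X i)}" for Y
      using that unfolding Z_def B'_def
      by (intro image_eqI[where x = "\<lambda>i. if Y i = topspace (X i) then None else Some (Y i)"])
        (auto simp: fun_eq_iff)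
    moreover have "countable Z"
      unfolding Z_def by (intro countable_product_event_const) (simp add: B(1))
    ultimately have "countable {Y. (\<forall>i. Y i \<in> B' i) \<and> finite {i. Y i \<noteq> topspace (X i)}}"
      using countable_subset[of _ "(\<lambda>z i. case z i of None \<Rightarrow> topspace (X i) | Some V \<Rightarrow> V) ` Z"]
      by (simp add: subset_iff)
    then show "countable K"
      unfolding K_def by simp
    show "openin (product_topology X UNIV) V" if "V \<in> K" for V
      using that B'_open unfolding K_def by (auto intro!: product_topology_basis)
    show "\<exists>V\<in>K. x \<in> V \<and> V \<subseteq> U" if U: "openin (product_topology X UNIV) U \<and> x \<in> U" for U x
    proof -
      obtain W where W: "x \<in> PiE UNIV W" "\<And>i. openin (X i) (W i)"
        "finite {i. W i \<noteq> topspace (X i)}" "PiE UNIV W \<subseteq> U"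
        using product_topology_open_contains_basis[of X UNIV U x] U by auto
      have "\<exists>V. V \<in> B' i \<and> x i \<in> V \<and> V \<subseteq> W i \<and> (W i = topspace (X i) \<longrightarrow> V = topspace (X i))" for i
      proof (cases "W i = topspace (X i)")
        case True
        then show ?thesis
          using W(1) by (auto simp: B'_def PiE_iff)
      next
        case False
        have "x i \<in> W i" using W(1) by auto
        then show ?thesis
          using B(3)[OF W(2)[of i] \<open>x i \<in> W i\<close>] False unfolding B'_def by auto
      qed
      then obtain Y where Y: "\<And>i. Y i \<in> B' i" "\<And>i. x i \<in> Y i" "\<And>i. Y i \<subseteq> W i"
        "\<And>i. W i = topspace (X i) \<Longrightarrow> Y i = topspace (X i)"
        by metis
      have "finite {i. Y i \<noteq> topspace (X i)}"
        using W(3) by (rule rev_finite_subset) (auto dest: Y(4))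
      then have "PiE UNIV Y \<in> K"
        using Y(1) unfolding K_def by blast
      moreover have "x \<in> PiE UNIV Y" "PiE UNIV Y \<subseteq> U"
        using Y(2,3) W(4) by (auto simp: PiE_iff subset_iff)
      ultimately show ?thesis by blast
    qed
  qed
qed

lemma second_countable_metric_dense:
  fixes D :: "'a::metric_space set"
  assumes "countable D" and dense: "\<And>x \<epsilon>. \<epsilon> > 0 \<Longrightarrow> \<exists>d\<in>D. dist d x < \<epsilon>"
  shows "second_countable (euclidean :: 'a topology)"
  unfolding second_countable_def
proof (intro exI conjI strip)
  let ?B = "(\<lambda>(d, n). ball d (1 / real (Suc n))) ` (D \<times> UNIV)"
  show "countable ?B"
    using assms(1) by simp
  show "openin euclidean V" if "V \<in> ?B" for V
    using that by auto
  show "\<exists>V\<in>?B. x \<in> V \<and> V \<subseteq> U" if U: "openin euclidean U \<and> x \<in> U" for U x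
  proof -
    obtain \<epsilon> where "\<epsilon> > 0" and \<epsilon>: "ball x \<epsilon> \<subseteq> U"
      using U by (metis open_contains_ball open_openin)
    obtain n where n: "1 / real (Suc n) < \<epsilon> / 2"
      using \<open>\<epsilon> > 0\<close> nat_approx_posE[of "\<epsilon> / 2"] by auto
    obtain d where "d \<in> D" and d: "dist d x < 1 / real (Suc n)"
      using dense[of "1 / real (Suc n)" x] by auto
    have "y \<in> ball x \<epsilon>" if "y \<in> ball d (1 / real (Suc n))" for y
      using that d n dist_triangle2[of x y d] by (simp add: dist_commute)
    then show ?thesis
      using \<open>d \<in> D\<close> d \<epsilon> by (intro bexI[of _ "ball d (1 / real (Suc n))"]) auto
  qed
qed

lemma Polish_space_homeomorphic:
  assumes "X homeomorphic_space Y" and "Polish_space X"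
  shows "Polish_space Y"
  using assms(2) homeomorphic_completely_metrizable_space[OF assms(1)]
    homeomorphic_space_second_countability[OF assms(1)]
  unfolding Polish_space_def by simp

lemma Polish_space_closedin:
  assumes "Polish_space X" and "closedin X C"
  shows "Polish_space (subtopology X C)"
  using assms unfolding Polish_space_def
  by (simp add: completely_metrizable_space_closedin second_countable_subtopology)

lemma Polish_space_discrete_topology:
  "countable U \<Longrightarrow> Polish_space (discrete_topology U)"
  by (simp add: Polish_space_def completely_metrizable_space_discrete_topology
      second_countable_discrete_topology)

lemma Polish_space_prod_topology:
  assumes "Polish_space X" and "Polish_space Y"
  shows "Polish_space (prod_topology X Y)"
  using assms unfolding Polish_space_def
  by (simp add: completely_metrizable_space_prod_topology second_countable_prod_topology)

lemma Polish_space_product_topology: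
  fixes X :: "'i::countable \<Rightarrow> 'a topology"
  assumes "\<And>i. Polish_space (X i)"
  shows "Polish_space (product_topology X UNIV)"
  using assms unfolding Polish_space_def
  by (simp add: completely_metrizable_space_product_topology second_countable_product_topology)

text \<open>
  A point of a Hausdorff space is determined by the members of a base that contain it. A countable
  base thus codes the points by sets of natural numbers, and there are as many of these as reals.
\<close>

lemma Polish_space_inj_real:
  assumes "Polish_space X"
  shows "\<exists>g :: 'a \<Rightarrow> real. inj_on g (topspace X)"
proof -
  obtain B where "countable B" "\<And>V. V \<in> B \<Longrightarrow> openin X V"
    and B: "\<And>U x. openin X U \<Longrightarrow> x \<in> U \<Longrightarrow> \<exists>V\<in>B. x \<in> V \<and> V \<subseteq> U"
    using assms unfolding Polish_space_def second_countable_def by metis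
  have haus: "Hausdorff_space X"
    using assms unfolding Polish_space_def
    by (simp add: completely_metrizable_imp_metrizable_space metrizable_imp_Hausdorff_space)
  define code where "code x = to_nat_on B ` {V \<in> B. x \<in> V}" for x
  have "inj_on code (topspace X)"
  proof (rule inj_onI, rule ccontr)
    fix x y assume xy: "x \<in> topspace X" "y \<in> topspace X" "code x = code y" "x \<noteq> y"
    then obtain U where "openin X U" "x \<in> U" "y \<notin> U"
      using haus unfolding Hausdorff_space_def disjnt_iff by metis
    then obtain V where V: "V \<in> B" "x \<in> V" "y \<notin> V"
      using B by blast
    then have "to_nat_on B V \<in> code y"
      using xy(3) by (auto simp: code_def)
    then obtain W where "W \<in> B" "y \<in> W" "to_nat_on B W = to_nat_on B V"
      by (auto simp: code_def)
    then show False
      using V \<open>countable B\<close> by (metis from_nat_into_to_nat_on)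
  qed
  moreover obtain h :: "nat set \<Rightarrow> real" where "inj h"
    using nat_sets_eqpoll_reals unfolding eqpoll_def bij_betw_def by blast
  ultimately have "inj_on (h \<circ> code) (topspace X)"
    by (simp add: comp_inj_on inj_on_subset)
  then show ?thesis by blast
qed

text \<open>
  Transport of structure along an injection. The topology on the image is in general unrelated to any
  topology that the target type may carry.
\<close>

lemma homeomorphic_space_pullback_inv_into:
  assumes "inj_on g (topspace X)"
  shows "X homeomorphic_space pullback_topology (g ` topspace X) (inv_into (topspace X) g) X"
    (is "_ homeomorphic_space ?Z")
proof -
  have top: "topspace ?Z = g ` topspace X"
    by (auto simp: topspace_pullback_topology assms)
  have "continuous_map X ?Z g"
  proof (rule continuous_map_pullback')
    show "continuous_map X X (inv_into (topspace X) g \<circ> g)"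
      by (rule continuous_map_eq[OF continuous_map_id]) (simp add: assms)
  qed auto
  moreover have "continuous_map ?Z X (inv_into (topspace X) g)"
    using continuous_map_pullback[OF continuous_map_id] by (metis id_comp)
  ultimately have "homeomorphic_maps X ?Z g (inv_into (topspace X) g)"
    unfolding homeomorphic_maps_def using assms top by (simp add: f_inv_into_f)
  then show ?thesis
    unfolding homeomorphic_space_def by blast
qed

text \<open>
  Analyticity is defined through Polish topologies on sets of reals. This rule frees it from that
  type, so that the natural parameter space can be used below.
\<close>

lemma analytic_inI:
  fixes X :: "'b topology"
  assumes "Polish_space X" and "continuous_map X T f" and "f ` topspace X = S"
  shows "analytic_in T S"
proof -
  obtain g :: "'b \<Rightarrow> real" where "inj_on g (topspace X)"
    using Polish_space_inj_real[OF assms(1)] by blast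
  then obtain Z :: "real topology" where Z: "X homeomorphic_space Z"
    using homeomorphic_space_pullback_inv_into by blast
  then obtain k where k: "homeomorphic_map Z X k"
    using homeomorphic_space homeomorphic_space_sym by blast
  have "continuous_map Z T (f \<circ> k)"
    using k assms(2) homeomorphic_imp_continuous_map continuous_map_compose by blast
  moreover have "(f \<circ> k) ` topspace Z = S"
    using homeomorphic_imp_surjective_map[OF k] assms(3) by (metis image_comp)
  ultimately show ?thesis
    unfolding analytic_in_def using Polish_space_homeomorphic[OF Z assms(1)] by blast
qed

section \<open>The coarsest filter of pointwise convergence to the identity\<close>

text \<open>
  The sets \<open>good_indices S m x\<close> form a base of the filter that is wanted. The number \<open>m\<close> serves at once as
  the beginning of a final segment, the number of terms of \<open>x\<close> that are approximated and the quality of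
  the approximation. Thus finite tuples of any length,
  with any tolerance, are coded in the single space of pairs \<open>(m, x)\<close>.
\<close>

definition good_indices :: "(nat \<Rightarrow> 'a::metric_space \<Rightarrow> 'a) \<Rightarrow> nat \<Rightarrow> (nat \<Rightarrow> 'a) \<Rightarrow> nat set"
  where "good_indices S m x = {n. m \<le> n \<and> (\<forall>i<m. dist (S n (x i)) (x i) < 1 / real (Suc m))}"

definition approx_filter :: "(nat \<Rightarrow> 'a::metric_space \<Rightarrow> 'a) \<Rightarrow> nat filter"
  where "approx_filter S = (INF (m, x). principal (good_indices S m x))"

text \<open>
  Concatenate the relevant initial parts of \<open>y\<close> and \<open>z\<close>, and add the two numbers: this lengthens the
  initial segment that is cut off, and lowers the tolerance, for both.
\<close>

lemma good_indices_directed: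
  "\<exists>m x. good_indices S m x \<subseteq> good_indices S k y \<inter> good_indices S l z"
proof -
  define x where "x i = (if i < k then y i else z (i - k))" for i
  have le: "1 / real (Suc (k + l)) \<le> 1 / real (Suc k)" "1 / real (Suc (k + l)) \<le> 1 / real (Suc l)"
    by (simp_all add: field_simps)
  have "n \<in> good_indices S k y \<inter> good_indices S l z" if n: "n \<in> good_indices S (k + l) x" for n
  proof -
    have bound: "dist (S n (x i)) (x i) < 1 / real (Suc (k + l))" if "i < k + l" for i
      using n that by (simp add: good_indices_def)
    have "dist (S n (y i)) (y i) < 1 / real (Suc k)" if "i < k" for i
      using bound[of i] that le(1) by (simp add: x_def)
    moreover have "dist (S n (z i)) (z i) < 1 / real (Suc l)" if "i < l" for i
      using bound[of "k + i"] that le(2) by (simp add: x_def)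
    ultimately show ?thesis
      using n by (simp add: good_indices_def)
  qed
  then show ?thesis by blast
qed

text \<open>
  By directedness one base set suffices for each member of the filter. So membership is a single
  existential quantifier over \<open>(m, x)\<close>, that is, a projection.
\<close>

lemma eventually_approx_filter:
  "eventually P (approx_filter S) \<longleftrightarrow> (\<exists>m x. \<forall>n\<in>good_indices S m x. P n)"
proof -
  have "eventually P (approx_filter S) \<longleftrightarrow>
      (\<exists>b\<in>UNIV. eventually P (case b of (m, x) \<Rightarrow> principal (good_indices S m x)))"
    unfolding approx_filter_def
  proof (rule eventually_INF_base)
    fix a b :: "nat \<times> (nat \<Rightarrow> 'a)"
    obtain m x where "good_indices S m x \<subseteq> good_indices S (fst a) (snd a) \<inter> good_indices S (fst b) (snd b)"
      using good_indices_directed by blast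
    then show "\<exists>c\<in>UNIV. (case c of (m, x) \<Rightarrow> principal (good_indices S m x))
        \<le> inf (case a of (m, x) \<Rightarrow> principal (good_indices S m x))
              (case b of (m, x) \<Rightarrow> principal (good_indices S m x))"
      by (intro bexI[of _ "(m, x)"]) (auto simp: case_prod_beta)
  qed simp
  then show ?thesis
    by (simp add: eventually_principal)
qed

lemma approx_filter_le_cofinite: "approx_filter S \<le> cofinite"
  unfolding cofinite_eq_sequentially le_sequentially
proof
  fix N
  show "eventually (\<lambda>n. N \<le> n) (approx_filter S)"
    unfolding eventually_approx_filter by (auto simp: good_indices_def)
qed

lemma tendsto_approx_filter: "((\<lambda>n. S n x) \<longlongrightarrow> x) (approx_filter S)"
proof (rule tendstoI)
  fix \<epsilon> :: real assume "\<epsilon> > 0"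
  then obtain m where m: "1 / real (Suc m) < \<epsilon>"
    by (meson nat_approx_posE)
  \<comment> \<open>With \<open>Suc m\<close> in place of \<open>m\<close>, at least one term of the constant sequence is approximated.\<close>
  have "1 / real (Suc (Suc m)) \<le> 1 / real (Suc m)"
    by (simp add: field_simps)
  then have "\<forall>n\<in>good_indices S (Suc m) (\<lambda>_. x). dist (S n x) x < \<epsilon>"
    using m by (auto simp: good_indices_def)
  then show "\<forall>\<^sub>F n in approx_filter S. dist (S n x) x < \<epsilon>"
    unfolding eventually_approx_filter by blast
qed

lemma le_approx_filter:
  assumes "F \<le> cofinite" and lim: "\<And>x. ((\<lambda>n. S n x) \<longlongrightarrow> x) F"
  shows "F \<le> approx_filter S"
proof -
  have "eventually (\<lambda>n. n \<in> good_indices S m x) F" for m x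
  proof -
    have "eventually (\<lambda>n. m \<le> n) F"
      using assms(1) unfolding cofinite_eq_sequentially le_sequentially by blast
    moreover have "eventually (\<lambda>n. \<forall>i<m. dist (S n (x i)) (x i) < 1 / real (Suc m)) F"
      using eventually_ball_finite_distrib[of "{..<m}" "\<lambda>n i. dist (S n (x i)) (x i) < 1 / real (Suc m)" F]
        tendstoD[OF lim, of "1 / real (Suc m)"] by (simp add: Ball_def)
    ultimately show ?thesis
      unfolding good_indices_def by (simp add: eventually_conj)
  qed
  then show ?thesis
    unfolding approx_filter_def by (auto intro!: INF_greatest simp: le_principal)
qed

text \<open>
  The relation ``\<open>good_indices S m x\<close> is contained in \<open>P\<close>'' says, for each \<open>n \<ge> m\<close>, that either one of
  finitely many weak inequalities between continuous functions of \<open>x\<close> holds or the \<open>n\<close>-th bit of \<open>P\<close> is set.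
  So it is closed in \<open>(m, x, P)\<close>, and the filter is its projection to the coordinate \<open>P\<close>.
\<close>

lemma analytic_approx_filter:
  fixes S :: "nat \<Rightarrow> 'a::metric_space \<Rightarrow> 'a"
  assumes "Polish_space (euclidean :: 'a topology)" and cont: "\<And>n. continuous_on UNIV (S n)"
  shows "analytic_filter (approx_filter S)"
proof -
  define C :: "(nat \<times> (nat \<Rightarrow> 'a) \<times> (nat \<Rightarrow> bool)) set"
    where "C = {p. \<forall>n\<in>good_indices S (fst p) (fst (snd p)). snd (snd p) n}"
  have Cantor: "Cantor_space = euclidean"
    unfolding Cantor_space_def
    by (metis discrete_topology_unique euclidean_product_topology open_discrete open_openin topspace_euclidean)
  have nat: "discrete_topology (UNIV::nat set) = euclidean"
    by (metis discrete_topology_unique open_discrete open_openin topspace_euclidean)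
  have "Polish_space (prod_topology (discrete_topology (UNIV::nat set))
    (prod_topology (product_topology (\<lambda>_::nat. euclidean :: 'a topology) UNIV) Cantor_space))"
    unfolding Cantor_space_def
    by (intro Polish_space_prod_topology Polish_space_product_topology assms(1)
        Polish_space_discrete_topology) auto
  then have Polish: "Polish_space (euclidean :: (nat \<times> (nat \<Rightarrow> 'a) \<times> (nat \<Rightarrow> bool)) topology)"
    by (simp add: Cantor nat euclidean_product_topology)
  \<comment> \<open>The value of \<open>fst p\<close> is fixed first, so that the disjunction over \<open>i\<close> ranges over a fixed finite set.\<close>
  have C_eq: "C = (\<Inter>m n. {p. fst p \<in> - {m} \<or> n < m \<or>
      (\<exists>i\<in>{..<m}. 1 / real (Suc m) \<le> dist (S n (fst (snd p) i)) (fst (snd p) i)) \<or>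
      snd (snd p) n \<in> {True}})"
    (is "_ = ?R")
  proof (intro set_eqI)
    fix p :: "nat \<times> (nat \<Rightarrow> 'a) \<times> (nat \<Rightarrow> bool)"
    obtain m x P where p: "p = (m, x, P)"
      by (cases p)
    have "(m, x, P) \<in> C \<longleftrightarrow>
        (\<forall>n. m \<le> n \<longrightarrow> (\<forall>i. i < m \<longrightarrow> dist (S n (x i)) (x i) < 1 / real (Suc m)) \<longrightarrow> P n)"
      unfolding C_def good_indices_def by (simp add: Ball_def imp_conjL)
    also have "\<dots> \<longleftrightarrow>
        (\<forall>n. n < m \<or> (\<exists>i. i < m \<and> 1 / real (Suc m) \<le> dist (S n (x i)) (x i)) \<or> P n)"
      by (simp only: imp_conv_disj de_Morgan_disj not_all not_not not_le not_less)
    also have "\<dots> \<longleftrightarrow> (m, x, P) \<in> ?R"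
      by (simp add: Bex_def)
    finally show "p \<in> C \<longleftrightarrow> p \<in> ?R"
      unfolding p .
  qed
  have coord: "continuous_on UNIV (\<lambda>p::nat \<times> (nat \<Rightarrow> 'a) \<times> (nat \<Rightarrow> bool). fst (snd p) i)" for i
    by (rule continuous_on_product_then_coordinatewise[where f = "\<lambda>p. fst (snd p)"])
      (intro continuous_intros)
  have bit: "continuous_on UNIV (\<lambda>p::nat \<times> (nat \<Rightarrow> 'a) \<times> (nat \<Rightarrow> bool). snd (snd p) n)" for n
    by (rule continuous_on_product_then_coordinatewise[where f = "\<lambda>p. snd (snd p)"])
      (intro continuous_intros)
  have Sc: "continuous_on UNIV (\<lambda>p::nat \<times> (nat \<Rightarrow> 'a) \<times> (nat \<Rightarrow> bool). S n (fst (snd p) i))" for n i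
    by (rule continuous_on_compose2[OF cont coord]) simp
  have "closed {p::nat \<times> (nat \<Rightarrow> 'a) \<times> (nat \<Rightarrow> bool). fst p \<in> - {m}}" for m
    using closed_vimage[of "- {m}" fst] by (simp add: vimage_def closed_open open_discrete continuous_on_fst)
  moreover have "closed {p::nat \<times> (nat \<Rightarrow> 'a) \<times> (nat \<Rightarrow> bool). snd (snd p) n \<in> {True}}" for n
    using closed_vimage[OF _ bit, of "{True}"] by (simp add: vimage_def)
  moreover have "closed {p::nat \<times> (nat \<Rightarrow> 'a) \<times> (nat \<Rightarrow> bool).
      \<exists>i\<in>{..<m}. c \<le> dist (S n (fst (snd p) i)) (fst (snd p) i)}" for m n c
    unfolding Collect_bex_eq
    by (intro closed_UN finite_lessThan ballI closed_Collect_le continuous_intros Sc coord)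
  ultimately have "closed C"
    unfolding C_eq by (intro closed_INT ballI closed_Collect_disj closed_Collect_const)
  then have "Polish_space (subtopology euclidean C)"
    using Polish Polish_space_closedin closed_closedin by blast
  moreover have "continuous_map (subtopology euclidean C) Cantor_space (snd \<circ> snd)"
    unfolding Cantor continuous_map_iff_continuous comp_def by (intro continuous_intros)
  moreover have "(snd \<circ> snd) ` topspace (subtopology euclidean C) = {P. eventually P (approx_filter S)}"
    unfolding eventually_approx_filter C_def by (force simp: image_iff)
  ultimately show ?thesis
    unfolding analytic_filter_def by (rule analytic_inI)
qed

section \<open>Spaces with a filter basis\<close>

text \<open>The scalar field embeds isometrically in \<open>\<complex>\<close>, and subspaces of \<open>\<complex>\<close> are separable.\<close>

lemma scalar_countable_dense:
  "\<exists>D :: 'k::real_or_complex set. countable D \<and> (\<forall>x \<epsilon>. \<epsilon> > 0 \<longrightarrow> (\<exists>d\<in>D. norm (x - d) < \<epsilon>))"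
proof -
  obtain h :: "'k \<Rightarrow> complex" where add: "\<And>x y. h (x + y) = h x + h y" and iso: "\<And>x. norm (h x) = norm x"
    using real_or_complex by metis
  have diff: "h (x - y) = h x - h y" for x y
    using add[of "x - y" y] by simp
  obtain T where T: "countable T" "T \<subseteq> range h" "range h \<subseteq> closure T"
    using separable by blast
  have "inj h"
    by (rule injI) (metis diff iso norm_eq_zero right_minus_eq)
  show ?thesis
  proof (intro exI conjI strip)
    show "countable (h -` T)"
      using T(1,2) \<open>inj h\<close> by (metis countable_image_inj_Int_vimage inf_top.left_neutral)
    fix x and \<epsilon> :: real assume "\<epsilon> > 0"
    then obtain t where "t \<in> T" "dist t (h x) < \<epsilon>"
      using T(3) by (meson closure_approachable rangeI subsetD)
    then obtain d where "h d = t" "d \<in> h -` T"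
      using T(2) by auto
    then show "\<exists>d\<in>h -` T. norm (x - d) < \<epsilon>"
      using \<open>dist t (h x) < \<epsilon>\<close> iso[of "x - d"] by (auto simp: diff dist_norm norm_minus_commute)
  qed
qed

context normed_space_over
begin

lemma dist_smul: "dist (smul a v) (smul b v) = norm (a - b) * norm v"
  by (simp add: dist_norm norm_smul flip: scale_left_diff_distrib)

lemma continuous_on_smul:
  assumes "continuous_on A f"
  shows "continuous_on A (\<lambda>x. smul (f x) v)"
proof -
  have "((\<lambda>y. smul (f y) v) \<longlongrightarrow> smul (f x) v) (at x within A)" if "x \<in> A" for x
  proof -
    have "((\<lambda>y. norm (f y - f x) * norm v) \<longlongrightarrow> norm (f x - f x) * norm v) (at x within A)"
      using assms that by (intro tendsto_intros) (auto simp: continuous_on_def)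
    then show ?thesis
      by (subst tendsto_dist_iff) (simp add: dist_smul)
  qed
  then show ?thesis
    by (auto simp: continuous_on_def)
qed

text \<open>
  Every vector is a limit, along a proper filter, of finite combinations of the \<open>e i\<close>, and the
  coefficients of such a combination can be perturbed into a countable dense set of scalars.
\<close>

lemma second_countable_if_expansions:
  assumes "F \<noteq> bot" and exp: "\<And>x. \<exists>a. has_filter_expansion F smul e a x"
  shows "second_countable (euclidean :: 'a topology)"
proof -
  obtain D :: "'k set" where "countable D"
    and D: "\<And>x \<epsilon>. \<epsilon> > 0 \<Longrightarrow> \<exists>d\<in>D. norm (x - d) < \<epsilon>"
    using scalar_countable_dense by metis
  define Q where "Q = (\<Union>n. (\<lambda>d. \<Sum>i\<le>n. smul (d i) (e i)) ` PiE {..n} (\<lambda>_. D))"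
  show ?thesis
  proof (rule second_countable_metric_dense)
    show "countable Q"
      unfolding Q_def using \<open>countable D\<close> by (intro countable_UN countable_image countable_PiE) auto
    fix x :: 'a and \<epsilon> :: real assume "\<epsilon> > 0"
    obtain a where "has_filter_expansion F smul e a x"
      using exp by blast
    then have "\<forall>\<^sub>F n in F. dist (\<Sum>i\<le>n. smul (a i) (e i)) x < \<epsilon> / 2"
      unfolding has_filter_expansion_def using \<open>\<epsilon> > 0\<close> by (intro tendstoD) auto
    then obtain n where n: "dist (\<Sum>i\<le>n. smul (a i) (e i)) x < \<epsilon> / 2"
      using \<open>F \<noteq> bot\<close> eventually_happens' by blast
    \<comment> \<open>This tolerance for the \<open>i\<close>-th coefficient splits \<open>\<epsilon> / 2\<close> evenly among the \<open>n + 1\<close> terms;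
      adding \<open>1\<close> to the norm keeps the denominator positive when \<open>e i = 0\<close>.\<close>
    define \<delta> where "\<delta> i = \<epsilon> / 2 / (real (Suc n) * (1 + norm (e i)))" for i
    have "\<delta> i > 0" for i
      using \<open>\<epsilon> > 0\<close> unfolding \<delta>_def by (intro divide_pos_pos mult_pos_pos add_pos_nonneg) auto
    then have "\<forall>i. \<exists>d. d \<in> D \<and> norm (a i - d) < \<delta> i"
      using D by blast
    then obtain d where d: "\<And>i. d i \<in> D" "\<And>i. norm (a i - d i) < \<delta> i"
      by metis
    have small: "norm (a i - d i) * norm (e i) \<le> \<epsilon> / 2 / real (Suc n)" for i
    proof -
      have "norm (a i - d i) * norm (e i) \<le> \<delta> i * (1 + norm (e i))"
        using d(2)[of i] \<open>\<delta> i > 0\<close> by (intro mult_mono) auto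
      also have "\<dots> = \<epsilon> / 2 / real (Suc n)"
        using norm_ge_zero[of "e i"] by (simp add: \<delta>_def field_simps add_nonneg_eq_0_iff)
      finally show ?thesis .
    qed
    have "dist (\<Sum>i\<le>n. smul (d i) (e i)) (\<Sum>i\<le>n. smul (a i) (e i))
        \<le> (\<Sum>i\<le>n. norm (a i - d i) * norm (e i))"
      unfolding dist_norm sum_subtractf[symmetric]
      by (rule order_trans[OF norm_sum])
        (simp add: norm_smul norm_minus_commute flip: scale_left_diff_distrib)
    also have "\<dots> \<le> (\<Sum>i\<le>n. \<epsilon> / 2 / real (Suc n))"
      by (intro sum_mono small)
    also have "\<dots> = \<epsilon> / 2"
      by (simp add: field_simps)
    finally have "dist (\<Sum>i\<le>n. smul (d i) (e i)) x < \<epsilon>"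
      using n dist_triangle[of "\<Sum>i\<le>n. smul (d i) (e i)" x "\<Sum>i\<le>n. smul (a i) (e i)"] by linarith
    moreover have "(\<Sum>i\<le>n. smul (d i) (e i)) \<in> Q"
      unfolding Q_def using d(1)
      by (intro UN_I[of n] image_eqI[where x = "restrict d {..n}"]) auto
    ultimately show "\<exists>q\<in>Q. dist q x < \<epsilon>" by blast
  qed
qed

text \<open>Along the improper filter everything converges to everything, so expansions are not unique.\<close>

lemma filter_basis_not_bot:
  fixes e :: "nat \<Rightarrow> 'a"
  assumes "filter_basis F smul e"
  shows "F \<noteq> bot"
proof
  assume "F = bot"
  then have "has_filter_expansion F smul e a 0" for a
    by (simp add: has_filter_expansion_def)
  moreover obtain b where "\<And>a. has_filter_expansion F smul e a 0 \<Longrightarrow> a = b"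
    using assms[unfolded filter_basis_def, THEN spec, of 0] unfolding Ex1_def by auto
  ultimately have "a = b" for a
    by blast
  from trans[OF this[of "\<lambda>_. 0"] this[of "\<lambda>_. 1", symmetric]] show False
    by (simp add: fun_eq_iff)
qed

end

theorem theoremB:
  fixes F :: "nat filter"
    and smul :: "'k::real_or_complex \<Rightarrow> 'a::banach \<Rightarrow> 'a"
    and e :: "nat \<Rightarrow> 'a"
  assumes "F \<le> cofinite"
    and "normed_space_over smul"
    and "filter_basis F smul e"
    and "\<And>n. continuous_on UNIV (coordinate_functional F smul e n)"
  shows "\<exists>F'. F' \<le> cofinite \<and>
      (\<forall>A. (\<forall>\<^sub>F n in F'. n \<in> A) \<longrightarrow> (\<forall>\<^sub>F n in F. n \<in> A)) \<and>
      analytic_filter F' \<and>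
      filter_basis F' smul e"
proof -
  interpret normed_space_over smul by fact
  define c where "c x = (\<lambda>n. coordinate_functional F smul e n x)" for x
  define S where "S n x = (\<Sum>i\<le>n. smul (c x i) (e i))" for n x
  have uniq: "\<exists>!a. has_filter_expansion F smul e a x" for x
    using assms(3) unfolding filter_basis_def by blast
  have exp: "has_filter_expansion F smul e (c x) x" for x
    unfolding c_def coordinate_functional_def using theI'[OF uniq] by simp
  have le: "F \<le> approx_filter S"
    by (rule le_approx_filter[OF assms(1)])
      (use exp in \<open>simp add: has_filter_expansion_def S_def\<close>)
  have "second_countable (euclidean :: 'a topology)"
    using second_countable_if_expansions[OF filter_basis_not_bot[OF assms(3)]] exp by blast
  then have "Polish_space (euclidean :: 'a topology)"
    unfolding Polish_space_def using completely_metrizable_space_euclidean by blast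
  moreover have "continuous_on UNIV (S n)" for n
    unfolding S_def[abs_def] c_def by (intro continuous_on_sum continuous_on_smul assms(4))
  ultimately have "analytic_filter (approx_filter S)"
    by (rule analytic_approx_filter)
  moreover have "filter_basis (approx_filter S) smul e"
    unfolding filter_basis_def
  proof (intro allI ex1I)
    fix x
    show "has_filter_expansion (approx_filter S) smul e (c x) x"
      using tendsto_approx_filter[of S x] unfolding has_filter_expansion_def S_def .
    fix a assume "has_filter_expansion (approx_filter S) smul e a x"
    then have "has_filter_expansion F smul e a x"
      unfolding has_filter_expansion_def using le by (rule tendsto_mono[rotated])
    then show "a = c x"
      using uniq[of x] exp[of x] by (auto elim: ex1E)
  qed
  moreover have "\<forall>A. (\<forall>\<^sub>F n in approx_filter S. n \<in> A) \<longrightarrow> (\<forall>\<^sub>F n in F. n \<in> A)"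
    using filter_leD[OF le] by simp
  ultimately show ?thesis
    using approx_filter_le_cofinite[of S] by (intro exI[of _ "approx_filter S"] conjI)
qed

end
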